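(* Let $G=(V,E)$ be a finite or infinite directed graph (locally finite and strongly connected), $\rho$ a collection of rotor stacks on $G$, and $\sigma_0$ a chip configuration on $G$. Fix a function $u_*\colon V\to\mathbb{N}$, and let $A_*=\{x\in V : u_*(x)>0\}$ be its support. Let $\sigma_*=\sigma_0+\Delta_\rho u_*$, and suppose that (i) $\sigma_*(x)\le 1$ for all $x\in V$; (ii) $A_*$ is finite; (iii) $\sigma_*(x)=1$ for all $x\in A_*$; and (iv) the rotor configuration $\mathrm{Top}_\rho(u_* )$ is acyclic on $A_*$. Then there exists a finite complete legal firing sequence for $\sigma_0$, and its odometer function is $u_*$.
   Context: $\mathbb{N}$ denotes the nonnegative integers. $G=(V,E)$ is a directed graph, finite or infinite; each edge $e$ goes from its source $\mathtt{s}(e)$ to its target $\mathtt{t}(e)$. Self-loops and multiple edges are permitted. $G$ is assumed locally finite (each vertex is incident to finitely many edges) and strongly connected. A collection of rotor stacks $\rho=(\rho_k(x))_{x\in V,k\in\mathbb{N}}$ assigns to each $x\in V$ and $k\ge 0$ an edge $\rho_k(x)\in E$ with $\mathtt{s}(\rho_k(x))=x$. A chip configuration is a function $\sigma\colon V\to\mathbb{Z}$ with finite support (negative values allowed). A rotor configuration is a function $r\colon V\to E$ with $\mathtt{s}(r(v))=v$ for all $v$. For $e\in E$, $n\in\mathbb{N}$, let $R_\rho(e,n)=\#\{1\le k\le n : \rho_k(\mathtt{s}(e))=e\}$. For $u\colon V\to\mathbb{N}$ the stack Laplacian is $\Delta_\rho u\colon V\to\mathbb{Z}$, $$\Delta_\rho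 u(x)=\sum_{e:\ \mathtt{t}(e)=x}R_\rho(e,u(\mathtt{s}(e)))-u(x).$$ The rotor configuration $\mathrm{Top}_\rho(u)$ is $\mathrm{Top}_\rho(u)(x)=\rho_{u(x)}(x)$. A rotor configuration $r$ is acyclic on $A\subset V$ if the spanning subgraph $(V,r(A))$, with edge set $r(A)=\{r(x):x\in A\}$, has no directed cycles (a self-loop is a directed cycle). A finite sequence of vertices $x_1,\dots,x_m$ ($m\ge 0$) is a legal firing sequence for $\sigma_0$ if $\sigma_j(x_{j+1})>1$ for $j=0,\dots,m-1$, where $u_j(x)=\#\{i\le j: x_i=x\}$ and $\sigma_j=\sigma_0+\Delta_\rho u_j$. It is complete if moreover $\sigma_m(x)\le 1$ for all $x\in V$. The odometer function of a complete legal firing sequence is $u_m$. (Known abelian property, due to Diaconis and Fulton: for given $\sigma_0$ and $\rho$, all complete legal firing sequences have the same odometer, which is called the odometer of $\sigma_0$.) *)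

theory Defs
  imports "Graph_Theory.Graph_Theory"
begin

text \<open>
  Graphs are given as \<open>pre_digraph\<close> records, so vertices and edges live in carrier sets
  of ambient types. Functions on vertices are total on the ambient type; only their values on
  \<open>verts G\<close> are ever inspected.
\<close>

definition locally_finite_digraph :: "('a, 'b) pre_digraph \<Rightarrow> bool" where
  "locally_finite_digraph G \<longleftrightarrow> (\<forall>x\<in>verts G. finite (in_arcs G x) \<and> finite (out_arcs G x))"

definition rotor_stacks :: "('a, 'b) pre_digraph \<Rightarrow> (nat \<Rightarrow> 'a \<Rightarrow> 'b) \<Rightarrow> bool" where
  "rotor_stacks G \<rho> \<longleftrightarrow> (\<forall>x\<in>verts G. \<forall>k. \<rho> k x \<in> arcs G \<and> tail G (\<rho> k x) = x)"

definition chip_configuration :: "('a, 'b) pre_digraph \<Rightarrow> ('a \<Rightarrow> int) \<Rightarrow> bool" where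
  "chip_configuration G \<sigma> \<longleftrightarrow> finite {x \<in> verts G. \<sigma> x \<noteq> 0}"

text \<open>The count starts at index 1: \<open>\<rho> 0\<close> is the initial rotor and is never used to move a chip.\<close>

definition rotor_count ::
    "('a, 'b) pre_digraph \<Rightarrow> (nat \<Rightarrow> 'a \<Rightarrow> 'b) \<Rightarrow> 'b \<Rightarrow> nat \<Rightarrow> nat" where
  "rotor_count G \<rho> e n = card {k. 1 \<le> k \<and> k \<le> n \<and> \<rho> k (tail G e) = e}"

definition stack_laplacian ::
    "('a, 'b) pre_digraph \<Rightarrow> (nat \<Rightarrow> 'a \<Rightarrow> 'b) \<Rightarrow> ('a \<Rightarrow> nat) \<Rightarrow> 'a \<Rightarrow> int" where
  "stack_laplacian G \<rho> u x =
     (\<Sum>e\<in>in_arcs G x. int (rotor_count G \<rho> e (u (tail G e)))) - int (u x)"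

definition Top :: "(nat \<Rightarrow> 'a \<Rightarrow> 'b) \<Rightarrow> ('a \<Rightarrow> nat) \<Rightarrow> 'a \<Rightarrow> 'b" where
  "Top \<rho> u x = \<rho> (u x) x"

text \<open>\<open>pre_digraph.cycle\<close> counts a self-loop as a cycle (of length 1).\<close>

definition acyclic_rotor_on :: "('a, 'b) pre_digraph \<Rightarrow> ('a \<Rightarrow> 'b) \<Rightarrow> 'a set \<Rightarrow> bool" where
  "acyclic_rotor_on G r A \<longleftrightarrow> \<not> (\<exists>p. pre_digraph.cycle (G\<lparr>arcs := r ` A\<rparr>) p)"

definition fired ::
    "('a, 'b) pre_digraph \<Rightarrow> (nat \<Rightarrow> 'a \<Rightarrow> 'b) \<Rightarrow> ('a \<Rightarrow> int) \<Rightarrow> ('a \<Rightarrow> nat) \<Rightarrow> 'a \<Rightarrow> int" where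
  "fired G \<rho> \<sigma>\<^sub>0 u x = \<sigma>\<^sub>0 x + stack_laplacian G \<rho> u x"

definition odometer_of :: "'a list \<Rightarrow> 'a \<Rightarrow> nat" where
  "odometer_of xs x = count_list xs x"

text \<open>Lists are indexed from 0, so \<open>xs ! j\<close> is the vertex fired after the first \<open>j\<close> firings.\<close>

definition legal_firing_sequence ::
    "('a, 'b) pre_digraph \<Rightarrow> (nat \<Rightarrow> 'a \<Rightarrow> 'b) \<Rightarrow> ('a \<Rightarrow> int) \<Rightarrow> 'a list \<Rightarrow> bool" where
  "legal_firing_sequence G \<rho> \<sigma>\<^sub>0 xs \<longleftrightarrow>
     set xs \<subseteq> verts G \<and>
     (\<forall>j<length xs. fired G \<rho> \<sigma>\<^sub>0 (odometer_of (take j xs)) (xs ! j) > 1)"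

definition complete_legal_firing_sequence ::
    "('a, 'b) pre_digraph \<Rightarrow> (nat \<Rightarrow> 'a \<Rightarrow> 'b) \<Rightarrow> ('a \<Rightarrow> int) \<Rightarrow> 'a list \<Rightarrow> bool" where
  "complete_legal_firing_sequence G \<rho> \<sigma>\<^sub>0 xs \<longleftrightarrow>
     legal_firing_sequence G \<rho> \<sigma>\<^sub>0 xs \<and>
     (\<forall>x\<in>verts G. fired G \<rho> \<sigma>\<^sub>0 (odometer_of xs) x \<le> 1)"

end

theory Submission
  imports Defs
begin

text \<open>
  Two facts carry the theorem. The first is the least action principle (\<open>legal_firing_le\<close>): a
  legal firing sequence can never fire a vertex more often than a function \<open>v\<close> whose final
  configuration has at most one chip at every vertex. Indeed, at the first moment at which a
  vertex \<open>x\<close> is about to exceed \<open>v x\<close>, every other vertex has fired at most as often as \<open>v\<close>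
  prescribes, so \<open>x\<close> has received at most as many chips as it does under \<open>v\<close>; hence it holds at
  most one chip and may not fire. With \<open>v\<close> of finite support this bounds the length of legal
  sequences, so a longest one exists, and a longest one is complete.

  The second fact shows that a complete sequence cannot stop early. Let \<open>u\<close> be its odometer and
  suppose that the set \<open>A\<close> of vertices with \<open>u x < v x\<close> is nonempty. Passing from \<open>u\<close> to \<open>v\<close>
  fires only vertices of \<open>A\<close>, so the number of chips in \<open>A\<close> can only drop, and it drops by the
  number of chips sent out of \<open>A\<close>. But \<open>v\<close> leaves exactly one chip at each vertex of \<open>A\<close> and \<open>u\<close>
  leaves at most one, so the number does not drop, and every one of these moves stays
  inside \<open>A\<close> (\<open>Top_stays_in_unfinished\<close>). The last move made from \<open>x\<close> is along the top rotor at
  \<open>x\<close>, so the top rotors send the finite set \<open>A\<close> into itself and therefore contain a directed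
  cycle, which acyclicity forbids.
\<close>

section \<open>Cycles in directed graphs\<close>

text \<open>
  Following such arcs for \<open>card A\<close> steps visits some vertex of \<open>A\<close> twice, and a closed walk
  contains a cycle.
\<close>

lemma (in wf_digraph) cycle_if_arcs_stay_inside:
  assumes "finite A" "A \<noteq> {}" "A \<subseteq> verts G"
    and stay: "\<And>x. x \<in> A \<Longrightarrow> \<exists>e\<in>arcs G. tail G e = x \<and> head G e \<in> A"
  shows "\<exists>p. cycle p"
proof -
  have walks: "\<exists>p b. awalk a p b \<and> length p = n \<and> set (awalk_verts a p) \<subseteq> A" if "a \<in> A" for a n
    using that
  proof (induction n arbitrary: a)
    case 0
    then show ?case
      using assms(3) by (intro exI[of _ "[]"] exI[of _ a]) (auto simp: awalk_Nil_iff)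
  next
    case (Suc n)
    obtain e where e: "e \<in> arcs G" "tail G e = a" "head G e \<in> A"
      using stay[OF Suc.prems] by blast
    obtain p b where p: "awalk (head G e) p b" "length p = n"
      "set (awalk_verts (head G e) p) \<subseteq> A"
      using Suc.IH[OF e(3)] by blast
    show ?case
      using e p Suc.prems by (intro exI[of _ "e # p"] exI[of _ b]) (auto simp: awalk_Cons_iff)
  qed
  obtain a where "a \<in> A"
    using assms(2) by blast
  then obtain p b where p: "awalk a p b" "length p = card A" "set (awalk_verts a p) \<subseteq> A"
    using walks by blast
  have "\<not> distinct (awalk_verts a p)"
  proof
    assume "distinct (awalk_verts a p)"
    then have "length (awalk_verts a p) \<le> card A"
      using p(3) assms(1) by (metis card_mono distinct_card)
    then show False
      using p(2) by (simp add: length_awalk_verts)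
  qed
  then obtain r where "closed_w r"
    using awalk_not_distinct_decomp[OF p(1)] by (auto simp: closed_w_def)
  then show ?thesis
    by (rule closed_w_imp_cycle)
qed

section \<open>Counting chip moves\<close>

lemma rotor_count_mono: "m \<le> n \<Longrightarrow> rotor_count G \<rho> e m \<le> rotor_count G \<rho> e n"
  unfolding rotor_count_def by (rule card_mono) auto

lemma rotor_count_diff:
  assumes "m \<le> n"
  shows "int (rotor_count G \<rho> e n) - int (rotor_count G \<rho> e m) =
         int (card {k \<in> {m<..n}. \<rho> k (tail G e) = e})"
proof -
  have "{k. 1 \<le> k \<and> k \<le> n \<and> \<rho> k (tail G e) = e} =
        {k. 1 \<le> k \<and> k \<le> m \<and> \<rho> k (tail G e) = e} \<union> {k \<in> {m<..n}. \<rho> k (tail G e) = e}"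
    using assms by auto
  then have "rotor_count G \<rho> e n =
        rotor_count G \<rho> e m + card {k \<in> {m<..n}. \<rho> k (tail G e) = e}"
    unfolding rotor_count_def by (simp add: card_Un_disjoint disjoint_iff)
  then show ?thesis
    by simp
qed

locale rotor_network = wf_digraph G for G :: "('a, 'b) pre_digraph" +
  fixes \<rho> :: "nat \<Rightarrow> 'a \<Rightarrow> 'b"
  assumes finite_in_arcs: "x \<in> verts G \<Longrightarrow> finite (in_arcs G x)"
    and rotor_in_arcs: "x \<in> verts G \<Longrightarrow> \<rho> k x \<in> arcs G"
    and tail_rotor: "x \<in> verts G \<Longrightarrow> tail G (\<rho> k x) = x"
begin

text \<open>
  A pair \<open>(y, k)\<close> with \<open>u y < k \<le> v y\<close> stands for one chip move on the way from \<open>u\<close> to \<open>v\<close>: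
  the \<open>k\<close>-th firing of \<open>y\<close>, which sends a chip along \<open>\<rho> k y\<close>. Indexing moves by such pairs
  rather than by edges presents the moves that end in \<open>A\<close> as a subset of those made by
  vertices of \<open>A\<close>, so that equal cardinality forces equality.
\<close>

definition moves :: "('a \<Rightarrow> nat) \<Rightarrow> ('a \<Rightarrow> nat) \<Rightarrow> 'a set \<Rightarrow> ('a \<times> nat) set" where
  "moves u v A = (SIGMA y:A. {u y<..v y})"

definition destination :: "'a \<times> nat \<Rightarrow> 'a" where
  "destination m = head G (\<rho> (snd m) (fst m))"

lemma finite_moves: "finite A \<Longrightarrow> finite (moves u v A)"
  by (simp add: moves_def)

lemma fired_diff:
  assumes x: "x \<in> verts G" and A: "finite A" "A \<subseteq> verts G"
    and le: "\<And>y. y \<in> verts G \<Longrightarrow> u y \<le> v y"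
    and eq: "\<And>y. y \<in> verts G - A \<Longrightarrow> u y = v y"
  shows "fired G \<rho> \<sigma> v x - fired G \<rho> \<sigma> u x =
         int (card {m \<in> moves u v A. destination m = x}) - (int (v x) - int (u x))"
proof -
  let ?along = "\<lambda>e. {m \<in> moves u v A. \<rho> (snd m) (fst m) = e}"
  have along: "int (rotor_count G \<rho> e (v (tail G e))) - int (rotor_count G \<rho> e (u (tail G e))) =
               int (card (?along e))"
    if "e \<in> in_arcs G x" for e
  proof -
    let ?K = "{k \<in> {u (tail G e)<..v (tail G e)}. \<rho> k (tail G e) = e}"
    have tail: "tail G e \<in> verts G"
      using that by (simp add: in_arcs_def)
    have "?along e = Pair (tail G e) ` ?K"
      using A(2) eq tail tail_rotor by (fastforce simp: moves_def image_iff)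
    then have "card (?along e) = card ?K"
      by (simp add: card_image inj_on_def)
    then show ?thesis
      using rotor_count_diff[OF le[OF tail]] by metis
  qed
  have "{m \<in> moves u v A. destination m = x} = (\<Union>e\<in>in_arcs G x. ?along e)"
    using A(2) rotor_in_arcs by (auto simp: moves_def destination_def in_arcs_def)
  then have "card {m \<in> moves u v A. destination m = x} = (\<Sum>e\<in>in_arcs G x. card (?along e))"
    using finite_in_arcs[OF x] finite_moves[OF A(1)]
    by (simp add: card_UN_disjoint disjoint_iff)
  then have "int (card {m \<in> moves u v A. destination m = x}) =
      (\<Sum>e\<in>in_arcs G x. int (rotor_count G \<rho> e (v (tail G e))) -
                         int (rotor_count G \<rho> e (u (tail G e))))"
    using along by simp
  then show ?thesis
    by (simp add: fired_def stack_laplacian_def sum_subtractf)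
qed

text \<open>
  Summing the change of \<open>fired\<close> over \<open>A\<close>, the chips in \<open>A\<close> decrease by the number of moves whose
  destination lies outside \<open>A\<close>. The hypothesis on \<open>A\<close> leaves no room for such a move, and for
  \<open>x \<in> A\<close> the top rotor at \<open>x\<close> carries one of the moves, the last one.
\<close>

lemma Top_stays_in_unfinished:
  assumes A: "A = {x \<in> verts G. u x < v x}" and fin: "finite A"
    and le: "\<And>y. y \<in> verts G \<Longrightarrow> u y \<le> v y"
    and no_loss: "\<And>x. x \<in> A \<Longrightarrow> fired G \<rho> \<sigma> u x \<le> fired G \<rho> \<sigma> v x"
    and x: "x \<in> A"
  shows "head G (Top \<rho> v x) \<in> A"
proof -
  let ?M = "moves u v A"
  let ?inside = "{m \<in> ?M. destination m \<in> A}"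
  have subset: "A \<subseteq> verts G"
    using A by auto
  have agree: "u y = v y" if "y \<in> verts G - A" for y
    using that le[of y] A by auto
  have "?inside = (\<Union>x\<in>A. {m \<in> ?M. destination m = x})"
    by auto
  then have inside: "card ?inside = (\<Sum>x\<in>A. card {m \<in> ?M. destination m = x})"
    using fin finite_moves[OF fin] by (simp add: card_UN_disjoint disjoint_iff)
  have "int (v x) - int (u x) = int (v x - u x)" if "x \<in> A" for x
    using that A by auto
  then have all: "int (card ?M) = (\<Sum>x\<in>A. int (v x) - int (u x))"
    unfolding moves_def using fin by simp
  have "0 \<le> (\<Sum>x\<in>A. fired G \<rho> \<sigma> v x - fired G \<rho> \<sigma> u x)"
    using no_loss by (intro sum_nonneg) simp
  also have "\<dots> = (\<Sum>x\<in>A. int (card {m \<in> ?M. destination m = x}) - (int (v x) - int (u x)))"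
  proof (rule sum.cong[OF refl])
    fix x assume "x \<in> A"
    then have "x \<in> verts G"
      using A by simp
    then show "fired G \<rho> \<sigma> v x - fired G \<rho> \<sigma> u x =
        int (card {m \<in> ?M. destination m = x}) - (int (v x) - int (u x))"
      using fin subset le agree by (rule fired_diff)
  qed
  also have "\<dots> = int (card ?inside) - int (card ?M)"
    unfolding inside all by (simp add: sum_subtractf)
  finally have "?inside = ?M"
    using finite_moves[OF fin] by (intro card_seteq) auto
  moreover have "(x, v x) \<in> ?M"
    using x A by (simp add: moves_def)
  ultimately have "(x, v x) \<in> ?inside"
    by blast
  then show ?thesis
    by (simp add: destination_def Top_def)
qed

section \<open>Legal firing sequences\<close>

text \<open>Firing the other vertices more often can only bring more chips to \<open>x\<close>.\<close>

lemma fired_mono: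
  assumes "x \<in> verts G" "\<And>y. y \<in> verts G \<Longrightarrow> u y \<le> v y" "u x = v x"
  shows "fired G \<rho> \<sigma> u x \<le> fired G \<rho> \<sigma> v x"
proof -
  have "(\<Sum>e\<in>in_arcs G x. int (rotor_count G \<rho> e (u (tail G e)))) \<le>
        (\<Sum>e\<in>in_arcs G x. int (rotor_count G \<rho> e (v (tail G e))))"
    using assms(2) by (intro sum_mono) (auto intro: rotor_count_mono simp: in_arcs_def)
  then show ?thesis
    using assms(3) by (simp add: fired_def stack_laplacian_def)
qed

lemma legal_firing_sequence_snoc:
  "legal_firing_sequence G \<rho> \<sigma> (xs @ [x]) \<longleftrightarrow>
   legal_firing_sequence G \<rho> \<sigma> xs \<and> x \<in> verts G \<and> fired G \<rho> \<sigma> (odometer_of xs) x > 1"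
  unfolding legal_firing_sequence_def by (auto simp: less_Suc_eq nth_append)

text \<open>
  The least action principle. A firing of \<open>x\<close> can break the bound only if \<open>x\<close> has already fired
  \<open>v x\<close> times, and then, by monotonicity, it holds at most as many chips as \<open>v\<close> leaves
  there, that is at most one.
\<close>

lemma legal_firing_le:
  assumes stable: "\<And>x. x \<in> verts G \<Longrightarrow> fired G \<rho> \<sigma> v x \<le> 1"
    and "legal_firing_sequence G \<rho> \<sigma> xs" and "y \<in> verts G"
  shows "odometer_of xs y \<le> v y"
  using assms(2,3)
proof (induction xs arbitrary: y rule: rev_induct)
  case Nil
  then show ?case
    by (simp add: odometer_of_def)
next
  case (snoc x xs)
  then have legal: "legal_firing_sequence G \<rho> \<sigma> xs" and x: "x \<in> verts G"
    and chips: "fired G \<rho> \<sigma> (odometer_of xs) x > 1"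
    by (auto simp: legal_firing_sequence_snoc)
  note le = snoc.IH[OF legal]
  have "odometer_of xs x \<noteq> v x"
  proof
    assume "odometer_of xs x = v x"
    with x le have "fired G \<rho> \<sigma> (odometer_of xs) x \<le> fired G \<rho> \<sigma> v x"
      by (intro fired_mono)
    then show False
      using chips stable[OF x] by linarith
  qed
  then have "odometer_of xs x < v x"
    using le[OF x] by simp
  then show ?case
    using le[OF snoc.prems(2)] by (auto simp: odometer_of_def)
qed

text \<open>
  The least action principle bounds the length of a legal sequence by the total number of firings
  in \<open>v\<close>, and a legal sequence of maximal length has no vertex left to fire.
\<close>

lemma complete_legal_firing_sequence_exists:
  assumes stable: "\<And>x. x \<in> verts G \<Longrightarrow> fired G \<rho> \<sigma> v x \<le> 1"
    and fin: "finite {x \<in> verts G. v x > 0}"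
  shows "\<exists>xs. complete_legal_firing_sequence G \<rho> \<sigma> xs"
proof -
  let ?A = "{x \<in> verts G. v x > 0}"
  have bounded: "length xs \<le> sum v ?A" if legal: "legal_firing_sequence G \<rho> \<sigma> xs" for xs
  proof -
    have verts: "set xs \<subseteq> verts G"
      using legal by (simp add: legal_firing_sequence_def)
    have le: "count_list xs x \<le> v x" if "x \<in> verts G" for x
      using legal_firing_le[OF stable legal that] by (simp add: odometer_of_def)
    have "set xs \<subseteq> ?A"
      using verts le by (fastforce simp: count_list_0_iff intro: gr0I)
    then have "length xs = sum (count_list xs) ?A"
      using fin by (simp add: sum_count_set)
    also have "\<dots> \<le> sum v ?A"
      using le by (intro sum_mono) auto
    finally show ?thesis .
  qed
  have "legal_firing_sequence G \<rho> \<sigma> []"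
    by (simp add: legal_firing_sequence_def)
  then obtain xs where legal: "legal_firing_sequence G \<rho> \<sigma> xs"
    and longest: "\<And>ys. legal_firing_sequence G \<rho> \<sigma> ys \<Longrightarrow> length ys \<le> length xs"
    using ex_has_greatest_nat[of "legal_firing_sequence G \<rho> \<sigma>" "[]" length "Suc (sum v ?A)"] bounded
    by (auto simp: less_Suc_eq_le)
  have "fired G \<rho> \<sigma> (odometer_of xs) x \<le> 1" if "x \<in> verts G" for x
  proof (rule ccontr)
    assume "\<not> ?thesis"
    then have "legal_firing_sequence G \<rho> \<sigma> (xs @ [x])"
      using legal that by (simp add: legal_firing_sequence_snoc)
    then show False
      using longest by fastforce
  qed
  with legal show ?thesis
    by (auto simp: complete_legal_firing_sequence_def)
qed

text \<open>
  On the vertices that still lack firings, \<open>v\<close> leaves one chip and \<open>xs\<close> at most one, so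
  \<open>Top_stays_in_unfinished\<close> traps the top rotors in this finite set; a trapped set of rotors has
  a cycle unless the set is empty.
\<close>

lemma complete_legal_odometer_eq:
  assumes stable: "\<And>x. x \<in> verts G \<Longrightarrow> fired G \<rho> \<sigma> v x \<le> 1"
    and S: "S = {x \<in> verts G. v x > 0}" "finite S"
    and occupied: "\<And>x. x \<in> S \<Longrightarrow> fired G \<rho> \<sigma> v x = 1"
    and acyclic: "acyclic_rotor_on G (Top \<rho> v) S"
    and complete: "complete_legal_firing_sequence G \<rho> \<sigma> xs" and "y \<in> verts G"
  shows "odometer_of xs y = v y"
proof -
  let ?u = "odometer_of xs"
  define A where "A = {x \<in> verts G. ?u x < v x}"
  have legal: "legal_firing_sequence G \<rho> \<sigma> xs"
    and halted: "\<And>x. x \<in> verts G \<Longrightarrow> fired G \<rho> \<sigma> ?u x \<le> 1"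
    using complete by (auto simp: complete_legal_firing_sequence_def)
  have le: "?u x \<le> v x" if "x \<in> verts G" for x
    using legal_firing_le[OF stable legal that] .
  have "A \<subseteq> S"
    by (auto simp: A_def S(1))
  then have "finite A"
    using S(2) finite_subset by blast
  have stay: "head G (Top \<rho> v x) \<in> A" if "x \<in> A" for x
  proof (rule Top_stays_in_unfinished[where \<sigma> = \<sigma>, OF A_def \<open>finite A\<close> le _ that])
    show "fired G \<rho> \<sigma> ?u z \<le> fired G \<rho> \<sigma> v z" if "z \<in> A" for z
      using that halted[of z] occupied[of z] \<open>A \<subseteq> S\<close> by (auto simp: A_def)
  qed
  let ?H = "G\<lparr>arcs := Top \<rho> v ` S\<rparr>"
  interpret H: wf_digraph ?H
    using S(1) rotor_in_arcs by unfold_locales (auto simp: Top_def)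
  have "A = {}"
  proof (rule ccontr)
    assume "A \<noteq> {}"
    moreover have "\<exists>e\<in>arcs ?H. tail ?H e = x \<and> head ?H e \<in> A" if "x \<in> A" for x
      using that stay \<open>A \<subseteq> S\<close> S(1) tail_rotor
      by (intro bexI[of _ "Top \<rho> v x"]) (auto simp: Top_def)
    ultimately have "\<exists>p. H.cycle p"
      using \<open>finite A\<close> by (intro H.cycle_if_arcs_stay_inside) (auto simp: A_def)
    then show False
      using acyclic by (simp add: acyclic_rotor_on_def)
  qed
  then show ?thesis
    using le[OF \<open>y \<in> verts G\<close>] \<open>y \<in> verts G\<close> by (auto simp: A_def)
qed

end

section \<open>Stable functions with acyclic top rotors are odometers\<close>

theorem theorem1:
  fixes G :: "('a, 'b) pre_digraph"
    and \<rho> :: "nat \<Rightarrow> 'a \<Rightarrow> 'b"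
    and \<sigma>\<^sub>0 \<sigma>star :: "'a \<Rightarrow> int"
    and ustar :: "'a \<Rightarrow> nat"
    and Astar :: "'a set"
  assumes "wf_digraph G"
    and "locally_finite_digraph G"
    and "strongly_connected G"
    and "rotor_stacks G \<rho>"
    and "chip_configuration G \<sigma>\<^sub>0"
    and "Astar = {x \<in> verts G. ustar x > 0}"
    and "\<sigma>star = fired G \<rho> \<sigma>\<^sub>0 ustar"
    and "\<forall>x\<in>verts G. \<sigma>star x \<le> 1"
    and "finite Astar"
    and "\<forall>x\<in>Astar. \<sigma>star x = 1"
    and "acyclic_rotor_on G (Top \<rho> ustar) Astar"
  shows "(\<exists>xs. complete_legal_firing_sequence G \<rho> \<sigma>\<^sub>0 xs) \<and>
         (\<forall>xs. complete_legal_firing_sequence G \<rho> \<sigma>\<^sub>0 xs \<longrightarrow>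
               (\<forall>x\<in>verts G. odometer_of xs x = ustar x))"
proof -
  interpret rotor_network G \<rho>
    using assms(1,2,4)
    by (simp add: rotor_network_def rotor_network_axioms_def locally_finite_digraph_def
        rotor_stacks_def)
  have stable: "fired G \<rho> \<sigma>\<^sub>0 ustar x \<le> 1" if "x \<in> verts G" for x
    using that assms(7,8) by simp
  show ?thesis
  proof (intro conjI allI impI ballI)
    show "\<exists>xs. complete_legal_firing_sequence G \<rho> \<sigma>\<^sub>0 xs"
      using stable assms(6,9) by (intro complete_legal_firing_sequence_exists) auto
  next
    fix xs x
    assume "complete_legal_firing_sequence G \<rho> \<sigma>\<^sub>0 xs" "x \<in> verts G"
    with stable assms(6,7,9-11) show "odometer_of xs x = ustar x"
      by (intro complete_legal_odometer_eq) auto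
  qed
qed

end
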